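(* There exists a compact set $E\subset\mathbb{R}^2$ of Hausdorff dimension $2$ such that for every $t>0$, the VC-dimension of $\mathcal{H}^2_t(E)$ is at most $2$.
   Context: Let $X$ be a set and $\mathcal{H}$ a collection of functions $X\to\{0,1\}$. $\mathcal{H}$ shatters a finite set $C\subset X$ if the restrictions to $C$ of the functions in $\mathcal{H}$ give every function $C\to\{0,1\}$. The VC-dimension of $\mathcal{H}$ is $n$ if some $C\subset X$ of size $n$ is shattered by $\mathcal{H}$ and no subset of $X$ of size $n+1$ is shattered; thus the VC-dimension is at most $2$ if no subset of $X$ of size $3$ is shattered. For a compact set $E\subset\mathbb{R}^2$ and $t>0$, $\mathcal{H}^2_t(E)=\{h_y:y\in E\}$ is the class of functions $h_y:E\to\{0,1\}$ (so $X=E$) given by $h_y(x)=1$ if $|x-y|=t$ and $h_y(x)=0$ otherwise, where $|\cdot|$ is the Euclidean norm. *)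

theory Defs
  imports "HOL-Analysis.Analysis"
begin

section \<open>VC-dimension\<close>

text \<open>A function \<open>X \<rightarrow> {0,1}\<close> is an element of the extensional function space
  \<^term>\<open>X \<rightarrow>\<^sub>E {0, 1 :: nat}\<close>, so that restrictions to \<open>C\<close> can be compared
  by equality.\<close>

definition shatters :: "('a \<Rightarrow> nat) set \<Rightarrow> 'a set \<Rightarrow> bool" where
  "shatters H C \<longleftrightarrow> (\<lambda>h. restrict h C) ` H = (C \<rightarrow>\<^sub>E {0, 1})"

text \<open>\<open>has_vc_dim X H n\<close>: the class \<open>H\<close> of functions \<open>X \<rightarrow> {0,1}\<close> has VC-dimension \<open>n\<close>.\<close>

definition has_vc_dim :: "'a set \<Rightarrow> ('a \<Rightarrow> nat) set \<Rightarrow> nat \<Rightarrow> bool" where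
  "has_vc_dim X H n \<longleftrightarrow>
     (\<exists>C. C \<subseteq> X \<and> finite C \<and> card C = n \<and> shatters H C) \<and>
     \<not> (\<exists>C. C \<subseteq> X \<and> finite C \<and> card C = n + 1 \<and> shatters H C)"

definition dist_indicator :: "(real^2) set \<Rightarrow> real \<Rightarrow> real^2 \<Rightarrow> (real^2 \<Rightarrow> nat)" where
  "dist_indicator E t y = (\<lambda>x\<in>E. if norm (x - y) = t then 1 else 0)"

definition dist_indicators :: "(real^2) set \<Rightarrow> real \<Rightarrow> (real^2 \<Rightarrow> nat) set" where
  "dist_indicators E t = dist_indicator E t ` E"

section \<open>Hausdorff measure and dimension\<close>

text \<open>The value \<open>diam(U)\<^sup>s\<close> with the usual conventions \<open>diam({})\<^sup>s = 0\<close> and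
  \<open>diam(U)\<^sup>0 = 1\<close> for nonempty \<open>U\<close>. They are explicit because \<open>0 powr 0 = 0\<close> in HOL.\<close>

definition diam_pow :: "real \<Rightarrow> 'a::metric_space set \<Rightarrow> ennreal" where
  "diam_pow s U = (if U = {} then 0 else if s = 0 then 1 else ennreal (diameter U powr s))"

text \<open>Boundedness of the covering sets has to be required separately: \<^const>\<open>diameter\<close>
  is real-valued and carries no information on unbounded sets.\<close>

definition hausdorff_premeasure :: "real \<Rightarrow> real \<Rightarrow> 'a::metric_space set \<Rightarrow> ennreal" where
  "hausdorff_premeasure s \<delta> A =
     Inf {(\<Sum>i. diam_pow s (U i)) | U :: nat \<Rightarrow> 'a set.
            A \<subseteq> (\<Union>i. U i) \<and> (\<forall>i. bounded (U i) \<and> diameter (U i) \<le> \<delta>)}"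

definition hausdorff_measure :: "real \<Rightarrow> 'a::metric_space set \<Rightarrow> ennreal" where
  "hausdorff_measure s A = (SUP \<delta>\<in>{0<..}. hausdorff_premeasure s \<delta> A)"

definition hausdorff_dim :: "'a::metric_space set \<Rightarrow> ennreal" where
  "hausdorff_dim A = Inf {ennreal s | s. 0 \<le> s \<and> hausdorff_measure s A = 0}"

end

theory Submission
  imports Defs "HOL-Real_Asymp.Real_Asymp"
begin

text \<open>The set is \<open>A \<times> A\<close> for a compact \<open>A \<subseteq> [0, 1]\<close> of dimension 1 without nontrivial solutions
  of \<open>a + b = c + d\<close>. Suppose \<open>x\<^sub>1, x\<^sub>2, x\<^sub>3\<close> are shattered and lie on the circle of radius \<open>t\<close>
  around \<open>y\<close>. The centre of the circle that contains just \<open>x\<^sub>i\<close> and \<open>x\<^sub>j\<close> is \<open>x\<^sub>i + x\<^sub>j - y\<close>, and if it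
  lies in \<open>A \<times> A\<close>, then each coordinate of \<open>y\<close> is a coordinate of \<open>x\<^sub>i\<close> or of \<open>x\<^sub>j\<close>. For three
  points and two coordinates this forces \<open>y = x\<^sub>i\<close> for some \<open>i\<close>, contradicting \<open>t > 0\<close>.

  \<open>A\<close> is obtained by prescribing sparse blocks of binary digits in a way that depends on the
  earlier digits: each dyadic interval from a cofinal family of levels is responsible for one
  block, where its points differ modulo 8 from all other points of \<open>A\<close> in a way
  that rules out the equation. Reading off the free digits maps \<open>A\<close> onto \<open>[0, 1)\<close>
  and is Hoelder of every exponent below 1, which gives the dimension.\<close>

section \<open>Bounds for the Hausdorff dimension\<close>

text \<open>Powers of a number in [0, 1] decrease with the exponent. The bound by 1 covers the
  convention at \<open>s = 0\<close>.\<close>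

lemma diameter_powr_le_diam_pow:
  assumes "U \<noteq> {}" "diameter U \<le> 1" "bounded U" "0 \<le> s" "s \<le> r" "0 < r"
  shows "ennreal (diameter U powr r) \<le> diam_pow s U"
proof -
  have d: "0 \<le> diameter U" using assms(3) by (rule diameter_ge_0)
  have "diameter U powr r \<le> 1"
    using d assms by (intro powr_le1) auto
  moreover have "diameter U powr r \<le> diameter U powr s"
    using d assms by (intro powr_mono') auto
  ultimately show ?thesis
    using assms(1) by (auto simp: diam_pow_def ennreal_le_1)
qed

text \<open>A countable cover of the image pulls back to a cover of the domain by sets contained in
  balls of radius \<open>C d\<^sup>s\<close>, where \<open>d\<close> is the diameter of the covering set; so Lebesgue measure
  plays the role of a Frostman measure, and no measurability of \<open>f\<close> is needed.\<close>

lemma hausdorff_measure_pos_of_Hoelder_inverse: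
  fixes f :: "'a::euclidean_space \<Rightarrow> 'b::metric_space"
  assumes hol: "\<And>u v. u \<in> S \<Longrightarrow> v \<in> S \<Longrightarrow> dist u v \<le> C * dist (f u) (f v) powr s"
    and S: "emeasure lborel S > 0"
    and fS: "f ` S \<subseteq> E"
    and s: "0 < s" and r: "0 \<le> r" "r \<le> s * DIM('a)"
  shows "hausdorff_measure r E > 0"
proof -
  define C' where "C' = max C 0"
  define V where "V = unit_ball_vol (real DIM('a)) * C' ^ DIM('a)"
  have V0: "0 \<le> V" by (simp add: V_def C'_def)
  have main: "emeasure lborel S \<le> ennreal V * (\<Sum>i. diam_pow r (U i))"
    if U: "E \<subseteq> (\<Union>i. U i)" "\<forall>i. bounded (U i) \<and> diameter (U i) \<le> 1" for U :: "nat \<Rightarrow> 'b set"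
  proof -
    have "\<exists>B. B \<in> sets lborel \<and> S \<inter> f -` U i \<subseteq> B \<and> emeasure lborel B \<le> ennreal V * diam_pow r (U i)" for i
    proof (cases "S \<inter> f -` U i = {}")
      case True
      then show ?thesis by (intro exI[of _ "{}"]) auto
    next
      case False
      then obtain p where p: "p \<in> S" "f p \<in> U i" by auto
      let ?d = "diameter (U i)"
      let ?B = "cball p (C' * ?d powr s)"
      have d: "0 \<le> ?d" "?d \<le> 1" using U(2) diameter_ge_0 by auto
      have "v \<in> ?B" if v: "v \<in> S" "f v \<in> U i" for v
      proof -
        have "dist (f p) (f v) \<le> ?d"
          using U(2) p v by (intro diameter_bounded_bound) auto
        hence "dist (f p) (f v) powr s \<le> ?d powr s"
          using s by (intro powr_mono2) auto
        hence "C * dist (f p) (f v) powr s \<le> C' * ?d powr s"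
          unfolding C'_def by (intro mult_mono) auto
        thus ?thesis using hol[OF p(1) v(1)] by simp
      qed
      moreover have "emeasure lborel ?B \<le> ennreal V * diam_pow r (U i)"
      proof -
        have "emeasure lborel ?B = ennreal (V * (?d powr (s * DIM('a))))"
          using d by (subst emeasure_cball)
            (auto simp: C'_def V_def power_mult_distrib powr_powr[symmetric] powr_realpow' mult_ac)
        also have "\<dots> = ennreal V * ennreal (?d powr (s * DIM('a)))"
          using V0 by (simp add: ennreal_mult)
        also have "\<dots> \<le> ennreal V * diam_pow r (U i)"
          using p U(2) r s by (intro mult_left_mono diameter_powr_le_diam_pow) auto
        finally show ?thesis .
      qed
      ultimately show ?thesis by (intro exI[of _ ?B]) auto
    qed
    then obtain B where B: "\<And>i. B i \<in> sets lborel" "\<And>i. S \<inter> f -` U i \<subseteq> B i"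
      "\<And>i. emeasure lborel (B i) \<le> ennreal V * diam_pow r (U i)" by metis
    have "S \<subseteq> (\<Union>i. B i)"
    proof
      fix u assume "u \<in> S"
      then obtain i where "f u \<in> U i" using fS U(1) by blast
      thus "u \<in> (\<Union>i. B i)" using B(2) \<open>u \<in> S\<close> by blast
    qed
    hence "emeasure lborel S \<le> emeasure lborel (\<Union>i. B i)"
      using B(1) by (intro emeasure_mono) auto
    also have "\<dots> \<le> (\<Sum>i. emeasure lborel (B i))"
      using B(1) by (intro emeasure_subadditive_countably) auto
    also have "\<dots> \<le> (\<Sum>i. ennreal V * diam_pow r (U i))"
      using B(3) by (intro suminf_le) auto
    finally show ?thesis by simp
  qed
  have "emeasure lborel S / ennreal V \<le> hausdorff_premeasure r 1 E"
    unfolding hausdorff_premeasure_def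
  proof (rule Inf_greatest, clarify)
    fix U :: "nat \<Rightarrow> 'b set"
    assume U: "E \<subseteq> (\<Union>i. U i)" "\<forall>i. bounded (U i) \<and> diameter (U i) \<le> 1"
    show "emeasure lborel S / ennreal V \<le> (\<Sum>i. diam_pow r (U i))"
    proof (cases "V = 0")
      \<comment> \<open>With \<open>V = 0\<close> the bound \<open>main\<close> would make
        \<open>S\<close> a null set.\<close>
      case True
      then show ?thesis using main[OF U] S by simp
    next
      case False
      then show ?thesis using main[OF U] V0
        by (intro divide_le_posI_ennreal) (auto simp: mult_ac)
    qed
  qed
  moreover have "emeasure lborel S / ennreal V > 0"
    using S by (simp add: ennreal_zero_less_divide)
  moreover have "hausdorff_premeasure r 1 E \<le> hausdorff_measure r E"
    unfolding hausdorff_measure_def by (rule SUP_upper) auto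
  ultimately show ?thesis by (metis less_le_trans)
qed

section \<open>Upper bound by a grid of squares\<close>

lemma grid_cover:
  fixes N :: nat
  assumes "N > 0" "x \<in> {0..1::real}"
  shows "\<exists>i<N. real i / real N \<le> x \<and> x \<le> (real i + 1) / real N"
proof (cases "x = 1")
  \<comment> \<open>At the right endpoint the floor would be \<open>N\<close>, so the last interval
    is taken.\<close>
  case True
  then show ?thesis using assms(1)
    by (intro exI[of _ "N - 1"]) (auto simp: of_nat_diff divide_simps)
next
  case False
  define i where "i = nat \<lfloor>real N * x\<rfloor>"
  have i: "real i \<le> real N * x" "real N * x < real i + 1"
    unfolding i_def using assms by (auto simp: of_nat_nat)
  have "real i < real N"
    using i(1) assms False by (smt (verit) atLeastAtMost_iff mult_less_cancel_left2 of_nat_0_less_iff)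
  thus ?thesis using i assms(1)
    by (intro exI[of _ i]) (auto simp: divide_simps mult_ac)
qed

lemma hausdorff_premeasure_unit_square_le:
  fixes E :: "(real^2) set" and N :: nat
  assumes E: "\<And>x k. x \<in> E \<Longrightarrow> x $ k \<in> {0..1}" and N: "N > 0" and \<delta>: "2 / real N \<le> \<delta>" and r: "r > 0"
  shows "hausdorff_premeasure r \<delta> E \<le> ennreal (real N ^ 2 * (2 / real N) powr r)"
proof -
  \<comment> \<open>Square \<open>n\<close> has column \<open>n div N\<close> and row
    \<open>n mod N\<close>. Beyond the grid the cover continues with empty sets, whose
    \<open>diam_pow\<close> is 0.\<close>
  define Q :: "nat \<Rightarrow> (real^2) set" where
    "Q n = {x. x $ 1 \<in> {real (n div N) / N .. (real (n div N) + 1) / N} \<and>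
               x $ 2 \<in> {real (n mod N) / N .. (real (n mod N) + 1) / N}}" for n
  define U where "U n = (if n < N * N then Q n else {})" for n
  have near: "norm (x - y) \<le> 2 / N" if "x \<in> U n" "y \<in> U n" for x y n
  proof -
    have "x \<in> Q n" "y \<in> Q n" using that by (auto simp: U_def split: if_splits)
    have "norm (x - y) \<le> \<bar>(x - y) $ 1\<bar> + \<bar>(x - y) $ 2\<bar>"
      using norm_le_l1_cart[of "x - y"] by (simp add: sum_2)
    also from \<open>x \<in> Q n\<close> \<open>y \<in> Q n\<close> have "\<dots> \<le> 1 / N + 1 / N"
      by (intro add_mono) (auto simp: Q_def abs_le_iff add_divide_distrib)
    finally show ?thesis by simp
  qed
  have diamQ: "diameter (U n) \<le> 2 / N" for n
    using near by (intro diameter_le) simp_all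
  have bdd: "bounded (U n)" for n
    unfolding bounded_two_points dist_norm using near by blast
  have cov: "E \<subseteq> (\<Union>n. U n)"
  proof
    fix x assume x: "x \<in> E"
    obtain i where i: "i < N" "real i / N \<le> x $ 1" "x $ 1 \<le> (real i + 1) / N"
      using grid_cover[OF N E[OF x]] by blast
    obtain j where j: "j < N" "real j / N \<le> x $ 2" "x $ 2 \<le> (real j + 1) / N"
      using grid_cover[OF N E[OF x]] by blast
    have "N * i + j < N * Suc i" using j by simp
    also have "\<dots> \<le> N * N" using i by (intro mult_le_mono) auto
    finally have "N * i + j < N * N" .
    hence "x \<in> U (N * i + j)" using i j N by (auto simp: U_def Q_def)
    thus "x \<in> (\<Union>n. U n)" by blast
  qed
  have "hausdorff_premeasure r \<delta> E \<le> (\<Sum>n. diam_pow r (U n))"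
    unfolding hausdorff_premeasure_def
    using cov bdd order_trans[OF diamQ \<delta>] by (intro Inf_lower) blast
  also have "\<dots> = (\<Sum>n<N * N. diam_pow r (U n))"
    by (rule suminf_finite) (auto simp: U_def diam_pow_def)
  also have "\<dots> \<le> (\<Sum>n<N * N. ennreal ((2 / N) powr r))"
    using r diamQ bdd by (intro sum_mono)
      (auto simp: diam_pow_def intro!: ennreal_leI powr_mono2 diameter_ge_0)
  also have "\<dots> = ennreal (real N ^ 2 * (2 / real N) powr r)"
    by (simp add: ennreal_mult power2_eq_square ennreal_of_nat_eq_real_of_nat)
  finally show ?thesis .
qed

lemma hausdorff_dim_unit_square_le:
  fixes E :: "(real^2) set"
  assumes E: "\<And>x k. x \<in> E \<Longrightarrow> x $ k \<in> {0..1}"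
  shows "hausdorff_dim E \<le> 2"
proof (rule ennreal_le_epsilon)
  fix e :: real assume e: "e > 0"
  have "hausdorff_premeasure (2 + e) \<delta> E = 0" if \<delta>: "\<delta> > 0" for \<delta>
  proof -
    \<comment> \<open>The bound is of order \<open>N powr (- e)\<close>.\<close>
    have "(\<lambda>N. real N ^ 2 * (2 / real N) powr (2 + e)) \<longlonglongrightarrow> 0"
      using e by real_asymp
    hence lim: "(\<lambda>N. ennreal (real N ^ 2 * (2 / real N) powr (2 + e))) \<longlonglongrightarrow> ennreal 0"
      by (rule tendsto_ennrealI)
    have "(\<lambda>N. 2 / real N) \<longlonglongrightarrow> 0" by real_asymp
    hence "\<forall>\<^sub>F N in sequentially. 2 / real N < \<delta>"
      using \<delta> by (rule order_tendstoD(2))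
    hence "\<forall>\<^sub>F N in sequentially. hausdorff_premeasure (2 + e) \<delta> E
             \<le> ennreal (real N ^ 2 * (2 / real N) powr (2 + e))"
      using eventually_gt_at_top[of 0]
      by eventually_elim (use e in \<open>auto intro!: hausdorff_premeasure_unit_square_le E\<close>)
    from tendsto_lowerbound[OF lim this] show ?thesis by simp
  qed
  hence "hausdorff_measure (2 + e) E = 0"
    by (simp add: hausdorff_measure_def cong: SUP_cong_simp)
  hence "hausdorff_dim E \<le> ennreal (2 + e)"
    unfolding hausdorff_dim_def using e by (intro Inf_lower) (auto intro!: exI[of _ "2 + e"])
  thus "hausdorff_dim E \<le> 2 + ennreal e" using e by (simp add: ennreal_plus)
qed

section \<open>A Sidon set of full dimension\<close>

text \<open>In the parametrization below, \<open>m\<^sup>2\<close> of the first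
  \<open>scale m\<close> binary digits are free and \<open>4 * m\<close> are prescribed, so the loss
  does not affect the dimension.\<close>

definition scale :: "nat \<Rightarrow> nat" where
  "scale m = m\<^sup>2 + 4 * m"

text \<open>Every dyadic interval of some level \<open>scale j\<close> is the one coded by some \<open>m \<ge> j\<close>;
  \<open>marked m a\<close> says that the interval of level \<open>scale m\<close> with left endpoint \<open>a / 2 ^ scale m\<close>
  lies inside the dyadic interval coded by \<open>m\<close>.\<close>

definition marked :: "nat \<Rightarrow> nat \<Rightarrow> bool" where
  "marked m a \<longleftrightarrow> a div 2 ^ (scale m - scale (fst (prod_decode m))) = snd (prod_decode m)"

text \<open>The points of \<open>[0, 1]\<close> whose binary digits at the places \<open>scale (Suc m) - 2, \<dots>,
  scale (Suc m) + 1\<close> are \<open>x000\<close>, where \<open>x = 1\<close> exactly if the preceding digits lead into the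
  interval coded by \<open>m\<close>. The last zero makes this a closed condition and prevents carries.\<close>

definition sidon_cantor :: "real set" where
  "sidon_cantor = {x \<in> {0..1}. \<forall>m. \<exists>a::nat. real a \<le> 2 ^ scale (Suc m) * x \<and>
     2 ^ scale (Suc m) * x \<le> real a + 1 / 2 \<and>
     a mod 8 = (if marked m (a div 2 ^ (2 * m + 5)) then 4 else 0)}"

lemma scale_0 [simp]: "scale 0 = 0"
  by (simp add: scale_def)

lemma scale_Suc: "scale (Suc m) = scale m + (2 * m + 5)"
  by (simp add: scale_def power2_eq_square)

lemma scale_mono: "i \<le> j \<Longrightarrow> scale i \<le> scale j"
  by (simp add: scale_def power_mono add_mono)

lemma le_scale: "m \<le> scale m"
  by (simp add: scale_def)

section \<open>Truncated binary expansions\<close>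

definition dyadic :: "nat \<Rightarrow> real \<Rightarrow> nat" where
  "dyadic k x = nat \<lfloor>2 ^ k * x\<rfloor>"

lemma dyadic_eqI:
  assumes "real a \<le> 2 ^ k * x" "2 ^ k * x < real a + 1"
  shows "dyadic k x = a"
  using assms unfolding dyadic_def by linarith

lemma dyadic_bounds:
  assumes "0 \<le> x"
  shows "real (dyadic k x) \<le> 2 ^ k * x" "2 ^ k * x < real (dyadic k x) + 1"
  using assms by (auto simp: dyadic_def of_nat_nat)

lemma dyadic_div:
  assumes "0 \<le> x" "i \<le> k"
  shows "dyadic k x div 2 ^ (k - i) = dyadic i x"
proof -
  have "2 ^ i * x = 2 ^ k * x / real_of_int (2 ^ (k - i))"
    using assms(2) by (simp add: field_simps flip: power_add)
  hence "\<lfloor>2 ^ i * x\<rfloor> = \<lfloor>2 ^ k * x\<rfloor> div 2 ^ (k - i)"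
    by (metis floor_divide_real_eq_div zero_le_numeral zero_le_power)
  thus ?thesis using assms(1) by (simp add: dyadic_def nat_div_distrib nat_power_eq)
qed

text \<open>Once \<open>2 ^ k * \<bar>x - y\<bar>\<close> exceeds 1, the two floors differ.\<close>

lemma dyadic_separates:
  assumes "0 \<le> x" "0 \<le> y" "x \<noteq> y"
  shows "\<exists>n. \<forall>k\<ge>n. dyadic k x \<noteq> dyadic k y"
proof -
  obtain n where n: "1 / \<bar>x - y\<bar> < 2 ^ n"
    using real_arch_pow[of 2 "1 / \<bar>x - y\<bar>"] by auto
  have "dyadic k x \<noteq> dyadic k y" if "k \<ge> n" for k
  proof
    assume eq: "dyadic k x = dyadic k y"
    have "1 / \<bar>x - y\<bar> < 2 ^ k"
      using n power_increasing[OF that, of "2::real"] by linarith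
    hence "1 < 2 ^ k * \<bar>x - y\<bar>"
      using assms(3) by (simp add: divide_simps)
    also have "\<dots> = \<bar>2 ^ k * x - 2 ^ k * y\<bar>"
      by (simp add: abs_mult flip: right_diff_distrib)
    also have "\<dots> < 1"
      using dyadic_bounds[OF assms(1), of k] dyadic_bounds[OF assms(2), of k] eq by linarith
    finally have "1 < (1 :: real)" .
    thus False by simp
  qed
  thus ?thesis by blast
qed

section \<open>The Sidon property and closedness\<close>

lemma sidon_cantorD:
  assumes "x \<in> sidon_cantor"
  shows "2 ^ scale (Suc m) * x \<le> real (dyadic (scale (Suc m)) x) + 1 / 2"
    and "dyadic (scale (Suc m)) x mod 8 = (if marked m (dyadic (scale m) x) then 4 else 0)"
proof -
  obtain a :: nat where a: "real a \<le> 2 ^ scale (Suc m) * x" "2 ^ scale (Suc m) * x \<le> real a + 1 / 2"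
    "a mod 8 = (if marked m (a div 2 ^ (2 * m + 5)) then 4 else 0)" and x: "0 \<le> x"
    using assms unfolding sidon_cantor_def by auto
  \<comment> \<open>The slack \<open>1 / 2\<close> is below 1, so the witness \<open>a\<close> can
    only be the floor.\<close>
  have *: "dyadic (scale (Suc m)) x = a"
    using a by (intro dyadic_eqI) auto
  show "2 ^ scale (Suc m) * x \<le> real (dyadic (scale (Suc m)) x) + 1 / 2"
    using a * by simp
  have "dyadic (scale (Suc m)) x div 2 ^ (2 * m + 5) = dyadic (scale m) x"
    using dyadic_div[OF x, of "scale m" "scale (Suc m)"] by (simp add: scale_Suc)
  thus "dyadic (scale (Suc m)) x mod 8 = (if marked m (dyadic (scale m) x) then 4 else 0)"
    using a(3) * by simp
qed

text \<open>Some dyadic interval contains \<open>p\<close> but none of \<open>q\<close>,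
  \<open>r\<close>, \<open>s\<close>. In the block it is responsible for, the truncation of
  \<open>p\<close> is 4 modulo 8 and the others are 0, while the equation would hold for the
  truncations up to an error of 1.\<close>

lemma sidon_cantor_isolated:
  assumes A: "p \<in> sidon_cantor" "q \<in> sidon_cantor" "r \<in> sidon_cantor" "s \<in> sidon_cantor"
    and ne: "p \<noteq> q" "p \<noteq> r" "p \<noteq> s"
  shows "p + q \<noteq> r + s"
proof
  assume eq: "p + q = r + s"
  have nonneg: "x \<ge> 0" if "x \<in> sidon_cantor" for x
    using that by (simp add: sidon_cantor_def)
  have "\<forall>y\<in>{q, r, s}. \<exists>n. \<forall>k\<ge>n. dyadic k p \<noteq> dyadic k y"
    using A ne by (auto intro!: dyadic_separates nonneg)
  then obtain n where n: "\<And>y k. y \<in> {q, r, s} \<Longrightarrow> k \<ge> n y \<Longrightarrow> dyadic k p \<noteq> dyadic k y"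
    by metis
  \<comment> \<open>The sum is at least each threshold, and \<open>le_scale\<close> carries this
    over to \<open>scale j\<close>.\<close>
  define j where "j = n q + n r + n s"
  have j: "dyadic (scale j) y \<noteq> dyadic (scale j) p" if "y \<in> {q, r, s}" for y
    using n[OF that, of "scale j"] le_scale[of j] that by (auto simp: j_def)
  define m where "m = prod_encode (j, dyadic (scale j) p)"
  have jm: "scale j \<le> scale m" unfolding m_def by (intro scale_mono le_prod_encode_1)
  have marked: "marked m (dyadic (scale m) x) \<longleftrightarrow> dyadic (scale j) x = dyadic (scale j) p"
    if "x \<in> sidon_cantor" for x
    using dyadic_div[OF nonneg[OF that] jm] by (simp add: marked_def m_def)
  define F where "F x = dyadic (scale (Suc m)) x" for x
  have F: "real (F x) \<le> 2 ^ scale (Suc m) * x" "2 ^ scale (Suc m) * x \<le> real (F x) + 1 / 2"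
    if "x \<in> sidon_cantor" for x
    unfolding F_def using sidon_cantorD(1)[OF that] dyadic_bounds[OF nonneg[OF that]] by auto
  have Fp: "F p mod 8 = 4"
    using sidon_cantorD(2)[OF A(1), of m] marked[OF A(1)] by (simp add: F_def)
  have Fy: "F y mod 8 = 0" if "y \<in> {q, r, s}" for y
    using sidon_cantorD(2)[of y m] marked[of y] j[OF that] that A by (auto simp: F_def)
  have "2 ^ scale (Suc m) * p + 2 ^ scale (Suc m) * q = 2 ^ scale (Suc m) * r + 2 ^ scale (Suc m) * s"
    using eq by (simp flip: distrib_left)
  \<comment> \<open>Each truncation loses between 0 and 1/2, so a sum of two loses between 0 and
    1.\<close>
  hence "\<bar>real (F p) + real (F q) - (real (F r) + real (F s))\<bar> \<le> 1"
    using F[OF A(1)] F[OF A(2)] F[OF A(3)] F[OF A(4)] by linarith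
  hence "F p + F q \<le> F r + F s + 1 \<and> F r + F s \<le> F p + F q + 1" by linarith
  moreover have "F q mod 8 = 0" "F r mod 8 = 0" "F s mod 8 = 0" using Fy by auto
  ultimately show False using Fp by presburger
qed

lemma sidon_cantor_sidon:
  assumes A: "a \<in> sidon_cantor" "b \<in> sidon_cantor" "c \<in> sidon_cantor" "d \<in> sidon_cantor"
    and eq: "a + b = c + d"
  shows "a = c \<or> a = d"
proof (rule ccontr)
  assume ne: "\<not> (a = c \<or> a = d)"
  show False
  proof (cases "a = b")
    case False
    then show False using sidon_cantor_isolated[OF A] ne eq by auto
  next
    case True
    \<comment> \<open>Here \<open>c = d\<close> would give \<open>2 * a = 2 * c\<close>, so now
      \<open>c\<close> is the point distinct from the other three.\<close>
    hence "c \<noteq> d" "c \<noteq> a" "c \<noteq> b" using ne eq by auto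
    then show False using sidon_cantor_isolated[OF A(3) A(4) A(1) A(2)] eq by simp
  qed
qed

lemma closed_sidon_cantor: "closed sidon_cantor"
proof -
  define P where "P m a \<longleftrightarrow> a mod 8 = (if marked m (a div 2 ^ (2 * m + 5)) then 4 else (0::nat))" for m a
  define K where "K m a = {x \<in> {0..1}. real a \<le> 2 ^ scale (Suc m) * x \<and> 2 ^ scale (Suc m) * x \<le> real a + 1 / 2}"
    for m a
  have K: "closed (K m a)" for m a
  proof -
    have "K m a = {0..1} \<inter> {x. real a \<le> 2 ^ scale (Suc m) * x} \<inter> {x. 2 ^ scale (Suc m) * x \<le> real a + 1 / 2}"
      by (auto simp: K_def)
    thus ?thesis by (auto intro!: closed_Int closed_Collect_le continuous_intros)
  qed
  \<comment> \<open>This leaves finitely many \<open>a\<close> for each \<open>m\<close>, so the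
    union of the closed sets \<open>K m a\<close> is closed.\<close>
  have "a \<le> 2 ^ scale (Suc m)" if "x \<in> K m a" for x m a
  proof -
    have "real a \<le> 2 ^ scale (Suc m) * x" "x \<le> 1" using that by (auto simp: K_def)
    hence "real a \<le> 2 ^ scale (Suc m) * 1"
      by (meson mult_left_mono order_trans zero_le_numeral zero_le_power)
    thus ?thesis by (simp flip: of_nat_le_iff)
  qed
  hence "sidon_cantor = (\<Inter>m. \<Union>a\<in>{a. a \<le> 2 ^ scale (Suc m) \<and> P m a}. K m a)"
    unfolding sidon_cantor_def P_def[symmetric] by (fastforce simp: K_def)
  also have "closed \<dots>"
    using K by (intro closed_INT closed_UN ballI) auto
  finally show ?thesis .
qed

section \<open>Parametrization by the free digits\<close>

primrec address :: "real \<Rightarrow> nat \<Rightarrow> nat" where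
  "address u 0 = 0"
| "address u (Suc m) = 2 ^ (2 * m + 5) * address u m +
     (8 * (dyadic ((Suc m)\<^sup>2) u mod 2 ^ (2 * m + 1)) + (if marked m (address u m) then 4 else 0))"

text \<open>Block \<open>m\<close> has \<open>2 * m + 5\<close> digits: a leading 0, the digits of
  \<open>u\<close> at the places \<open>m\<^sup>2 + 1\<close> to \<open>(Suc m)\<^sup>2\<close>,
  then \<open>x00\<close> with \<open>x\<close> given by the mark. The leading 0 completes the
  pattern \<open>x000\<close> begun by the preceding block.\<close>

definition address_digit :: "real \<Rightarrow> nat \<Rightarrow> nat" where
  "address_digit u m = 8 * (dyadic ((Suc m)\<^sup>2) u mod 2 ^ (2 * m + 1)) + (if marked m (address u m) then 4 else 0)"

lemma address_Suc: "address u (Suc m) = 2 ^ (2 * m + 5) * address u m + address_digit u m"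
  by (simp add: address_digit_def)

declare address.simps(2) [simp del]

text \<open>Half the block size as a bound expresses the leading 0; the added 1 leaves room for the
  later digits.\<close>

lemma address_digit_less: "address_digit u m + 1 \<le> 2 ^ (2 * m + 4)"
proof -
  define k where "k = dyadic ((Suc m)\<^sup>2) u mod 2 ^ (2 * m + 1)"
  have "k < 2 ^ (2 * m + 1)" unfolding k_def by (rule mod_less_divisor) simp
  hence "8 * Suc k \<le> 8 * 2 ^ (2 * m + 1)"
    by (intro mult_le_mono) auto
  also have "\<dots> = (2::nat) ^ (2 * m + 4)" by (simp add: power_add)
  finally show ?thesis unfolding address_digit_def k_def[symmetric] by auto
qed

lemma address_Suc_div: "address u (Suc m) div 2 ^ (2 * m + 5) = address u m"
proof -
  have "(2::nat) ^ (2 * m + 5) = 2 * 2 ^ (2 * m + 4)" by (simp add: power_add)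
  hence "address_digit u m < 2 ^ (2 * m + 5)" using address_digit_less[of u m] by linarith
  thus ?thesis by (simp add: address_Suc)
qed

lemma address_Suc_mod: "address u (Suc m) mod 8 = (if marked m (address u m) then 4 else 0)"
proof -
  have "address u (Suc m) = 8 * (2 ^ (2 * m + 2) * address u m + dyadic ((Suc m)\<^sup>2) u mod 2 ^ (2 * m + 1))
     + (if marked m (address u m) then 4 else 0)"
    by (simp add: address.simps(2) power_add algebra_simps)
  also have "\<dots> mod 8 = (if marked m (address u m) then 4 else 0)"
    by (subst mod_mult_self4) simp
  finally show ?thesis .
qed

text \<open>The intervals from \<open>lower u m\<close> to \<open>upper u m\<close> are left halves
  of dyadic intervals of level \<open>scale m\<close>. They are nested because each block starts
  with 0, and they shrink to \<open>cantor_param u\<close>.\<close>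

definition lower :: "real \<Rightarrow> nat \<Rightarrow> real" where
  "lower u m = real (address u m) / 2 ^ scale m"

definition upper :: "real \<Rightarrow> nat \<Rightarrow> real" where
  "upper u m = (real (address u m) + 1 / 2) / 2 ^ scale m"

definition cantor_param :: "real \<Rightarrow> real" where
  "cantor_param u = (SUP m. lower u m)"

lemma incseq_lower: "incseq (lower u)"
proof (rule incseq_SucI)
  fix m
  have "real (address u (Suc m)) \<ge> 2 ^ (2 * m + 5) * real (address u m)"
    by (simp add: address_Suc)
  thus "lower u m \<le> lower u (Suc m)"
    by (simp add: lower_def scale_Suc power_add divide_simps mult_ac)
qed

lemma decseq_upper: "decseq (upper u)"
proof (rule decseq_SucI)
  fix m
  define D where "D = address_digit u m"
  have "real (D + 1) \<le> real (2 ^ (2 * m + 4))"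
    unfolding D_def by (intro of_nat_mono address_digit_less)
  hence "real D + 1 / 2 \<le> 2 ^ (2 * m + 5) / 2" by (simp add: power_add)
  moreover have "real (address u (Suc m)) = 2 ^ (2 * m + 5) * real (address u m) + real D"
    by (simp add: address_Suc D_def)
  ultimately have "real (address u (Suc m)) + 1 / 2 \<le> 2 ^ (2 * m + 5) * (real (address u m) + 1 / 2)"
    by (simp add: distrib_left)
  hence "upper u (Suc m) \<le> 2 ^ (2 * m + 5) * (real (address u m) + 1 / 2) / 2 ^ scale (Suc m)"
    unfolding upper_def by (intro divide_right_mono) auto
  also have "\<dots> = upper u m"
    by (simp add: upper_def scale_Suc power_add)
  finally show "upper u (Suc m) \<le> upper u m" .
qed

lemma cantor_param_bounds: "lower u m \<le> cantor_param u" "cantor_param u \<le> upper u m"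
proof -
  have le: "lower u i \<le> upper u j" for i j
  proof -
    have "lower u i \<le> lower u (max i j)" using incseq_lower by (simp add: incseq_def)
    also have "\<dots> \<le> upper u (max i j)" by (simp add: lower_def upper_def divide_right_mono)
    also have "\<dots> \<le> upper u j" using decseq_upper by (simp add: decseq_def)
    finally show ?thesis .
  qed
  have "bdd_above (range (lower u))" using le by (auto intro: bdd_aboveI[of _ "upper u 0"])
  thus "lower u m \<le> cantor_param u"
    unfolding cantor_param_def by (rule cSUP_upper2) auto
  show "cantor_param u \<le> upper u m"
    unfolding cantor_param_def using le by (intro cSUP_least) auto
qed

lemma cantor_param_scaled:
  "real (address u m) \<le> 2 ^ scale m * cantor_param u"
  "2 ^ scale m * cantor_param u \<le> real (address u m) + 1 / 2"
  using cantor_param_bounds[of u m] by (auto simp: lower_def upper_def field_simps)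

lemma cantor_param_in_sidon_cantor: "cantor_param u \<in> sidon_cantor"
proof -
  have "0 \<le> cantor_param u" "cantor_param u \<le> 1"
    using cantor_param_scaled[where u=u and m=0] by auto
  moreover have "\<exists>a::nat. real a \<le> 2 ^ scale (Suc m) * cantor_param u \<and>
     2 ^ scale (Suc m) * cantor_param u \<le> real a + 1 / 2 \<and>
     a mod 8 = (if marked m (a div 2 ^ (2 * m + 5)) then 4 else 0)" for m
    using cantor_param_scaled[where u=u and m="Suc m"] address_Suc_mod[of u m] address_Suc_div[of u m]
    by metis
  ultimately show ?thesis by (simp add: sidon_cantor_def)
qed

text \<open>The mark at level \<open>m\<close> depends on \<open>u\<close> only through
  \<open>address u m\<close>, so by induction no digit of \<open>u\<close> beyond place
  \<open>m\<^sup>2\<close> enters.\<close>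

lemma address_cong:
  fixes u v :: real
  assumes "0 \<le> u" "0 \<le> v" "dyadic (m\<^sup>2) u = dyadic (m\<^sup>2) v"
  shows "address u m = address v m"
  using assms(3)
proof (induction m)
  case (Suc m)
  have "dyadic (m\<^sup>2) u = dyadic (m\<^sup>2) v"
    using dyadic_div[OF assms(1), of "m\<^sup>2" "(Suc m)\<^sup>2"] dyadic_div[OF assms(2), of "m\<^sup>2" "(Suc m)\<^sup>2"]
      Suc.prems by (simp add: power_mono)
  with Suc show ?case by (simp add: address.simps(2))
qed simp

text \<open>\<open>m\<close> is the last level at which \<open>u\<close> and \<open>v\<close> agree to \<open>m\<^sup>2\<close> binary places.\<close>

lemma cantor_param_expands:
  fixes u v :: real
  assumes u: "0 \<le> u" "u < 1" and v: "0 \<le> v" "v < 1" and ne: "u \<noteq> v"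
  obtains m where "\<bar>u - v\<bar> \<le> 2 ^ (4 * Suc m) * \<bar>cantor_param u - cantor_param v\<bar>"
    and "\<bar>u - v\<bar> \<le> 1 / 2 ^ m\<^sup>2"
proof -
  obtain n0 where "\<forall>k\<ge>n0. dyadic k u \<noteq> dyadic k v"
    using dyadic_separates[OF u(1) v(1) ne] by blast
  hence "dyadic (n0\<^sup>2) u \<noteq> dyadic (n0\<^sup>2) v" by (simp add: power2_eq_square)
  hence ex: "\<exists>n. dyadic (n\<^sup>2) u \<noteq> dyadic (n\<^sup>2) v" by blast
  define n where "n = (LEAST n. dyadic (n\<^sup>2) u \<noteq> dyadic (n\<^sup>2) v)"
  have n: "dyadic (n\<^sup>2) u \<noteq> dyadic (n\<^sup>2) v" unfolding n_def using ex by (rule LeastI_ex)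
  \<comment> \<open>Both floors vanish on [0, 1), so the least index is a successor.\<close>
  have "dyadic (0\<^sup>2) u = dyadic (0\<^sup>2) v" using u v by (simp add: dyadic_def)
  with n obtain m where m: "n = Suc m" by (cases n) auto
  have eq: "dyadic (m\<^sup>2) u = dyadic (m\<^sup>2) v"
    using not_less_Least[of m "\<lambda>n. dyadic (n\<^sup>2) u \<noteq> dyadic (n\<^sup>2) v"] m by (auto simp: n_def)
  define k where "k x = dyadic (n\<^sup>2) x mod 2 ^ (2 * m + 1)" for x
  have split: "dyadic (n\<^sup>2) x = 2 ^ (2 * m + 1) * dyadic (m\<^sup>2) x + k x" if "0 \<le> x" for x
  proof -
    have e: "n\<^sup>2 - m\<^sup>2 = 2 * m + 1" by (simp add: m power2_eq_square)
    have "dyadic (n\<^sup>2) x div 2 ^ (2 * m + 1) = dyadic (m\<^sup>2) x"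
      using dyadic_div[OF that, of "m\<^sup>2" "n\<^sup>2"] e by (simp add: m power_mono)
    thus ?thesis unfolding k_def by (metis mult_div_mod_eq)
  qed
  define D where "D = \<bar>real (k u) - real (k v)\<bar>"
  have "k u \<noteq> k v" using n eq split[OF u(1)] split[OF v(1)] by auto
  hence D1: "1 \<le> D" unfolding D_def by linarith
  have dD: "\<bar>real (dyadic (n\<^sup>2) u) - real (dyadic (n\<^sup>2) v)\<bar> = D"
    using eq split[OF u(1)] split[OF v(1)] by (simp add: D_def)
  have "2 ^ n\<^sup>2 * \<bar>u - v\<bar> = \<bar>2 ^ n\<^sup>2 * u - 2 ^ n\<^sup>2 * v\<bar>"
    by (simp add: abs_mult flip: right_diff_distrib)
  also have "\<dots> \<le> D + 1"
    using dyadic_bounds[OF u(1), of "n\<^sup>2"] dyadic_bounds[OF v(1), of "n\<^sup>2"] dD by linarith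
  finally have 1: "2 ^ n\<^sup>2 * \<bar>u - v\<bar> \<le> D + 1" .
  have "address u m = address v m" using address_cong[OF u(1) v(1) eq] .
  \<comment> \<open>Equal addresses at level \<open>m\<close> carry the same mark, so only the free
    digits contribute.\<close>
  hence "real (address u n) - real (address v n) = 8 * (real (k u) - real (k v))"
    by (simp add: m k_def address.simps(2))
  hence "\<bar>real (address u n) - real (address v n)\<bar> = 8 * D"
    by (simp only: D_def abs_mult abs_numeral)
  hence "8 * D - 1 / 2 \<le> \<bar>2 ^ scale n * cantor_param u - 2 ^ scale n * cantor_param v\<bar>"
    using cantor_param_scaled[where u=u and m=n] cantor_param_scaled[where u=v and m=n] by linarith
  also have "\<dots> = 2 ^ scale n * \<bar>cantor_param u - cantor_param v\<bar>"
    by (simp add: abs_mult flip: right_diff_distrib)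
  finally have "8 * D - 1 / 2 \<le> 2 ^ n\<^sup>2 * (2 ^ (4 * n) * \<bar>cantor_param u - cantor_param v\<bar>)"
    by (simp add: scale_def power_add mult_ac)
  \<comment> \<open>Since \<open>D \<ge> 1\<close>,
    \<open>D + 1 \<le> 8 * D - 1 / 2\<close>.\<close>
  hence "2 ^ n\<^sup>2 * \<bar>u - v\<bar> \<le> 2 ^ n\<^sup>2 * (2 ^ (4 * n) * \<bar>cantor_param u - cantor_param v\<bar>)"
    using 1 D1 by linarith
  hence A: "\<bar>u - v\<bar> \<le> 2 ^ (4 * Suc m) * \<bar>cantor_param u - cantor_param v\<bar>"
    by (simp add: m)
  have "2 ^ m\<^sup>2 * \<bar>u - v\<bar> = \<bar>2 ^ m\<^sup>2 * u - 2 ^ m\<^sup>2 * v\<bar>"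
    by (simp add: abs_mult flip: right_diff_distrib)
  also have "\<dots> \<le> 1"
    using dyadic_bounds[OF u(1), of "m\<^sup>2"] dyadic_bounds[OF v(1), of "m\<^sup>2"] eq by linarith
  finally have "\<bar>u - v\<bar> \<le> 1 / 2 ^ m\<^sup>2" by (simp add: divide_simps mult_ac)
  with A that show ?thesis by blast
qed

text \<open>Interpolation: the first bound of \<open>cantor_param_expands\<close> is used to the
  power \<open>s\<close>, the second to the power \<open>1 - s\<close>. The decay in
  \<open>m\<^sup>2\<close> of the second absorbs the factor exponential in \<open>m\<close> of the
  first.\<close>

lemma cantor_param_Hoelder_inverse:
  fixes u v :: real
  assumes s: "0 < s" "s < 1"
    and u: "0 \<le> u" "u < 1" and v: "0 \<le> v" "v < 1"
  shows "\<bar>u - v\<bar> \<le> 2 powr (4 + 4 / (1 - s)) * \<bar>cantor_param u - cantor_param v\<bar> powr s"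
proof (cases "u = v")
  case False
  define c where "c = 1 - s"
  have c: "0 < c" using s by (simp add: c_def)
  define d where "d = \<bar>cantor_param u - cantor_param v\<bar>"
  obtain m where m: "\<bar>u - v\<bar> \<le> 2 ^ (4 * Suc m) * d" "\<bar>u - v\<bar> \<le> 1 / 2 ^ m\<^sup>2"
    using cantor_param_expands[OF u v False] unfolding d_def by blast
  have "\<bar>u - v\<bar> = \<bar>u - v\<bar> powr s * \<bar>u - v\<bar> powr c"
    by (simp add: c_def flip: powr_add)
  also have "\<dots> \<le> (2 ^ (4 * Suc m) * d) powr s * (1 / 2 ^ m\<^sup>2) powr c"
    using m s c by (intro mult_mono powr_mono2) auto
  also have "\<dots> = 2 powr (4 * (real m + 1) * s - c * (real m)\<^sup>2) * d powr s"
  proof -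
    have "(2 ^ (4 * Suc m) :: real) = 2 powr (4 * (real m + 1))"
      by (subst powr_realpow[symmetric]) (auto simp: algebra_simps)
    moreover have "(1 / 2 ^ m\<^sup>2 :: real) = 2 powr (- ((real m)\<^sup>2))"
      using powr_realpow[of 2 "m\<^sup>2"] by (simp add: powr_minus_divide)
    ultimately have "(2 ^ (4 * Suc m) * d) powr s * (1 / 2 ^ m\<^sup>2) powr c
        = 2 powr (4 * (real m + 1) * s) * d powr s * 2 powr (- (real m)\<^sup>2 * c)"
      by (simp only: powr_mult powr_powr)
    thus ?thesis
      by (simp add: powr_diff powr_minus_divide mult_ac)
  qed
  also have "\<dots> \<le> 2 powr (4 + 4 / c) * d powr s"
  proof (intro mult_right_mono powr_mono)
    have "4 * (real m + 1) * s \<le> 4 * (real m + 1)"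
      using s by (intro mult_left_le) auto
    \<comment> \<open>Completing the square; the maximum is at \<open>m = 2 / c\<close>.\<close>
    moreover have "4 * real m - c * (real m)\<^sup>2 \<le> 4 / c"
    proof -
      have "0 \<le> (c * real m - 2)\<^sup>2" by simp
      hence "c * (4 * real m - c * (real m)\<^sup>2) \<le> 4"
        by (simp add: power2_eq_square algebra_simps)
      thus ?thesis using c by (simp add: pos_le_divide_eq mult_ac)
    qed
    ultimately show "4 * (real m + 1) * s - c * (real m)\<^sup>2 \<le> 4 + 4 / c"
      by argo
  qed auto
  finally show ?thesis by (simp add: c_def d_def)
qed auto

section \<open>The product set\<close>

definition sidon_square :: "(real^2) set" where
  "sidon_square = {x. \<forall>k. x $ k \<in> sidon_cantor}"

lemma sidon_square_unit: "x \<in> sidon_square \<Longrightarrow> x $ k \<in> {0..1}"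
  by (simp add: sidon_square_def sidon_cantor_def)

lemma compact_sidon_square: "compact sidon_square"
proof -
  have "closed ((\<lambda>x::real^2. x $ k) -` sidon_cantor)" for k
    by (intro continuous_closed_vimage closed_sidon_cantor continuous_intros)
  moreover have "sidon_square = (\<Inter>k. (\<lambda>x::real^2. x $ k) -` sidon_cantor)"
    by (auto simp: sidon_square_def)
  ultimately have "closed sidon_square" by (metis closed_INT)
  moreover have "sidon_square \<subseteq> cbox 0 1"
    using sidon_square_unit by (force simp: mem_box_cart)
  hence "bounded sidon_square" using bounded_cbox bounded_subset by blast
  ultimately show ?thesis by (simp add: compact_eq_bounded_closed)
qed

lemma hausdorff_measure_sidon_square_pos:
  assumes "0 \<le> r" "r < 2"
  shows "hausdorff_measure r sidon_square > 0"
proof -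
  \<comment> \<open>The midpoint of \<open>r / 2\<close> and 1.\<close>
  define s where "s = (r / 2 + 1) / 2"
  have s: "0 < s" "s < 1" "r \<le> s * 2" using assms by (auto simp: s_def)
  define f :: "real^2 \<Rightarrow> real^2" where "f u = (\<chi> k. cantor_param (u $ k))" for u
  define S :: "(real^2) set" where "S = box 0 1"
  define C where "C = 2 powr (4 + 4 / (1 - s))"
  show ?thesis
  proof (rule hausdorff_measure_pos_of_Hoelder_inverse)
    fix u v assume uv: "u \<in> S" "v \<in> S"
    have comp: "\<bar>(u - v) $ k\<bar> \<le> C * dist (f u) (f v) powr s" for k
    proof -
      have "\<bar>u $ k - v $ k\<bar> \<le> C * \<bar>cantor_param (u $ k) - cantor_param (v $ k)\<bar> powr s"
        unfolding C_def using uv s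
        by (intro cantor_param_Hoelder_inverse) (auto simp: S_def mem_box_cart less_imp_le)
      also have "\<dots> \<le> C * dist (f u) (f v) powr s"
        using s component_le_norm_cart[of "f u - f v" k]
        by (intro mult_left_mono powr_mono2) (auto simp: C_def f_def dist_norm)
      finally show ?thesis by simp
    qed
    have "dist u v \<le> \<bar>(u - v) $ 1\<bar> + \<bar>(u - v) $ 2\<bar>"
      using norm_le_l1_cart[of "u - v"] by (simp add: sum_2 dist_norm)
    also have "\<dots> \<le> 2 * C * dist (f u) (f v) powr s"
      using comp[of 1] comp[of 2] by linarith
    finally show "dist u v \<le> 2 * C * dist (f u) (f v) powr s" .
  next
    show "f ` S \<subseteq> sidon_square"
      by (auto simp: f_def sidon_square_def cantor_param_in_sidon_cantor)
  next
    have "emeasure lborel S = ennreal (\<Prod>b\<in>Basis. (1 - 0 :: real^2) \<bullet> b)"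
      unfolding S_def by (rule emeasure_lborel_box) (auto simp: Basis_vec_def inner_axis)
    also have "(\<Prod>b\<in>Basis. (1 - 0 :: real^2) \<bullet> b) = 1"
      by (rule prod.neutral) (auto simp: Basis_vec_def inner_axis)
    finally show "emeasure lborel S > 0" by simp
  qed (use s assms in auto)
qed

lemma hausdorff_dim_sidon_square: "hausdorff_dim sidon_square = 2"
proof (rule antisym)
  show "hausdorff_dim sidon_square \<le> 2"
    by (rule hausdorff_dim_unit_square_le) (rule sidon_square_unit)
  show "2 \<le> hausdorff_dim sidon_square"
    unfolding hausdorff_dim_def
  proof (rule Inf_greatest, clarify)
    fix r :: real assume "0 \<le> r" "hausdorff_measure r sidon_square = 0"
    hence "2 \<le> r" using hausdorff_measure_sidon_square_pos[of r] by force
    thus "2 \<le> ennreal r" by (metis ennreal_leI ennreal_numeral)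
  qed
qed

section \<open>Shattering\<close>

text \<open>Both centres lie on the perpendicular bisector of \<open>x\<close> and
  \<open>x'\<close>, equally far from the midpoint, so they are its reflections of each
  other.\<close>

lemma two_circles_meet_symmetric:
  fixes x x' y z :: "real^2"
  assumes "x \<noteq> x'" "y \<noteq> z"
    and "norm (x - y) = t" "norm (x' - y) = t" "norm (x - z) = t" "norm (x' - z) = t"
  shows "y + z = x + x'"
proof -
  have sq: "(a $ 1 - b $ 1)\<^sup>2 + (a $ 2 - b $ 2)\<^sup>2 = t\<^sup>2" if "norm (a - b) = t" for a b :: "real^2"
  proof -
    have "(norm (a - b))\<^sup>2 = (a $ 1 - b $ 1)\<^sup>2 + (a $ 2 - b $ 2)\<^sup>2"
      unfolding power2_norm_eq_inner by (simp add: inner_vec_def sum_2 power2_eq_square)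
    thus ?thesis using that by simp
  qed
  \<comment> \<open>\<open>d\<close> is the chord; \<open>p\<close> and \<open>q\<close> are twice
    the offsets of \<open>y\<close> and \<open>z\<close> from its midpoint.\<close>
  define d1 d2 where "d1 = x' $ 1 - x $ 1" "d2 = x' $ 2 - x $ 2"
  define p1 p2 where "p1 = 2 * y $ 1 - x $ 1 - x' $ 1" "p2 = 2 * y $ 2 - x $ 2 - x' $ 2"
  define q1 q2 where "q1 = 2 * z $ 1 - x $ 1 - x' $ 1" "q2 = 2 * z $ 2 - x $ 2 - x' $ 2"
  note defs = d1_d2_def p1_p2_def q1_q2_def
  note e = assms(3-6)[THEN sq]
  have pd: "p1 * d1 + p2 * d2 = 0" using e(1,2) unfolding defs by (simp add: power2_eq_square algebra_simps)
  have qd: "q1 * d1 + q2 * d2 = 0" using e(3,4) unfolding defs by (simp add: power2_eq_square algebra_simps)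
  have pq: "p1\<^sup>2 + p2\<^sup>2 = q1\<^sup>2 + q2\<^sup>2" using e unfolding defs by (simp add: power2_eq_square algebra_simps)
  have d: "d1 \<noteq> 0 \<or> d2 \<noteq> 0" using assms(1) unfolding defs by (auto simp: vec_eq_iff forall_2)
  have "(p1 * q2 - p2 * q1) * d1 = 0" "(p1 * q2 - p2 * q1) * d2 = 0"
    using pd qd by algebra+
  hence det: "p1 * q2 - p2 * q1 = 0" using d by auto
  \<comment> \<open>Lagrange's identity for parallel vectors of equal length, factored: they are
    equal or opposite.\<close>
  have "(p1 * q1 + p2 * q2 - (p1\<^sup>2 + p2\<^sup>2)) * (p1 * q1 + p2 * q2 + (p1\<^sup>2 + p2\<^sup>2)) = 0"
    using det pq by algebra
  moreover have "p1 * q1 + p2 * q2 - (p1\<^sup>2 + p2\<^sup>2) \<noteq> 0"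
  proof
    assume "p1 * q1 + p2 * q2 - (p1\<^sup>2 + p2\<^sup>2) = 0"
    hence "(p1 - q1)\<^sup>2 + (p2 - q2)\<^sup>2 = 0" using pq by algebra
    hence "y = z" unfolding defs by (simp add: sum_power2_eq_zero_iff vec_eq_iff forall_2)
    thus False using assms(2) by simp
  qed
  ultimately have "p1 * q1 + p2 * q2 + (p1\<^sup>2 + p2\<^sup>2) = 0" by simp
  hence "(p1 + q1)\<^sup>2 + (p2 + q2)\<^sup>2 = 0" using pq by algebra
  thus ?thesis unfolding defs by (simp add: sum_power2_eq_zero_iff vec_eq_iff forall_2)
qed

lemma shattersD_dist_indicators:
  assumes sh: "shatters (dist_indicators E t) C" and "C \<subseteq> E" "T \<subseteq> C"
  obtains y where "y \<in> E" "\<And>x. x \<in> C \<Longrightarrow> norm (x - y) = t \<longleftrightarrow> x \<in> T"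
proof -
  define g :: "real^2 \<Rightarrow> nat" where "g = (\<lambda>x\<in>C. if x \<in> T then 1 else 0)"
  have "g \<in> C \<rightarrow>\<^sub>E {0, 1}" by (auto simp: g_def)
  then obtain y where y: "y \<in> E" "g = restrict (dist_indicator E t y) C"
    using sh unfolding shatters_def dist_indicators_def by (metis (no_types, lifting) imageE)
  have "norm (x - y) = t \<longleftrightarrow> x \<in> T" if x: "x \<in> C" for x
  proof -
    have "(if x \<in> T then 1 else 0 :: nat) = (if norm (x - y) = t then 1 else 0)"
      using fun_cong[OF y(2), of x] x assms(2) by (auto simp: g_def dist_indicator_def)
    thus ?thesis by (simp split: if_splits)
  qed
  with y(1) that show ?thesis by blast
qed

lemma sidon_square_no_shattered_triple:
  assumes t: "t > 0" and C: "C \<subseteq> sidon_square" "card C = 3"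
  shows "\<not> shatters (dist_indicators sidon_square t) C"
proof
  assume sh: "shatters (dist_indicators sidon_square t) C"
  obtain y where y: "y \<in> sidon_square" "\<And>x. x \<in> C \<Longrightarrow> norm (x - y) = t"
    using shattersD_dist_indicators[OF sh C(1), of C] by auto
  have share: "y $ k = a $ k \<or> y $ k = b $ k" if ab: "a \<in> C" "b \<in> C" "a \<noteq> b" for a b k
  proof -
    obtain z where z: "z \<in> sidon_square" "\<And>x. x \<in> C \<Longrightarrow> norm (x - z) = t \<longleftrightarrow> x \<in> {a, b}"
      using shattersD_dist_indicators[OF sh C(1), of "{a, b}"] ab by auto
    \<comment> \<open>The third point separates the centres: it is on the circle around
      \<open>y\<close> but not on the one around \<open>z\<close>.\<close>
    have "C \<noteq> {a, b}" using C(2) ab(3) by auto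
    then obtain c where "c \<in> C" "c \<notin> {a, b}" using ab by auto
    hence "y \<noteq> z" using y(2) z(2) by metis
    hence "y + z = a + b"
      using ab y(2) z(2) by (intro two_circles_meet_symmetric[of a b y z t]) auto
    hence "y $ k + z $ k = a $ k + b $ k" by (metis vector_add_component)
    thus ?thesis
      using y(1) z(1) ab C(1) by (intro sidon_cantor_sidon) (auto simp: sidon_square_def)
  qed
  obtain a b c where abc: "C = {a, b, c}" "a \<noteq> b" "a \<noteq> c" "b \<noteq> c"
    using C(2) by (auto simp: card_3_iff)
  \<comment> \<open>In each coordinate at most one of the three points disagrees with
    \<open>y\<close>, so with two coordinates some point agrees in both.\<close>
  have "\<exists>x\<in>C. \<forall>k. y $ k = x $ k"
    using share[of a b] share[of a c] share[of b c] abc unfolding forall_2 by auto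
  then obtain x where "x \<in> C" "y = x" by (auto simp: vec_eq_iff)
  thus False using y(2)[of x] t by simp
qed

text \<open>A nonempty class shatters the empty set, so between sizes 0 and 3 there is a size that
  is shattered while the next one is not.\<close>

lemma has_vc_dim_le_2I:
  assumes "H \<noteq> {}" and no: "\<And>C. C \<subseteq> X \<Longrightarrow> card C = 3 \<Longrightarrow> \<not> shatters H C"
  shows "\<exists>n\<le>2. has_vc_dim X H n"
proof -
  define P where "P n \<longleftrightarrow> (\<exists>C. C \<subseteq> X \<and> finite C \<and> card C = n \<and> shatters H C)" for n
  have "P 0" unfolding P_def using assms(1)
    by (intro exI[of _ "{}"]) (auto simp: shatters_def restrict_def)
  moreover have "\<not> P 3" using no by (auto simp: P_def)
  ultimately have "\<exists>n\<le>2. P n \<and> \<not> P (n + 1)"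
    by (cases "P 1"; cases "P 2") (auto simp: eval_nat_numeral le_Suc_eq)
  thus ?thesis by (simp add: has_vc_dim_def P_def)
qed

theorem corollary1p8:
  "\<exists>E :: (real^2) set. compact E \<and> hausdorff_dim E = 2 \<and>
     (\<forall>t::real. t > 0 \<longrightarrow> (\<exists>n\<le>2. has_vc_dim E (dist_indicators E t) n))"
proof (intro exI[of _ sidon_square] conjI allI impI)
  show "compact sidon_square" by (rule compact_sidon_square)
  show "hausdorff_dim sidon_square = 2" by (rule hausdorff_dim_sidon_square)
  fix t :: real assume t: "t > 0"
  have "(\<chi> k. cantor_param 0) \<in> sidon_square"
    by (simp add: sidon_square_def cantor_param_in_sidon_cantor)
  hence "dist_indicators sidon_square t \<noteq> {}" by (auto simp: dist_indicators_def)
  thus "\<exists>n\<le>2. has_vc_dim sidon_square (dist_indicators sidon_square t) n"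
    using sidon_square_no_shattered_triple[OF t] by (intro has_vc_dim_le_2I)
qed

end
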